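(* Let $H:\mathbb R_+\to(0,1)$ be continuous and satisfy: (H1) there are constants $0<h_1<h_2<1$ with $h_1\le H_t\le h_2$ for all $t\ge0$; (H2) there are constants $D>0$, $\kappa\in(0,1]$ with $|H_t-H_s|\le D|t-s|^\kappa$ for all $t\ge s>0$; and assume $\min\{h_1,\kappa\}>1/2$. Let $Y$ be the multifractional Brownian motion with Hurst function $H$, $x_0\in\mathbb R$, and let $X$ be the solution of $X_t=x_0+\theta\int_0^tX_s\,ds+Y_t$, $t\ge0$, where the true parameter is $\theta=0$. Define \[ \hat\theta_T=\frac{\int_0^TX_s\,dX_s}{\int_0^TX_s^2\,ds}. \] Then $\hat\theta_T\to\theta=0$ in probability as $T\to\infty$.
   Context: The (harmonizable) multifractional Brownian motion with continuous functional parameter $H$ is $Y(t)=\int_{\mathbb R}\frac{e^{itu}-1}{|u|^{H_t+1/2}}\widetilde W(du)$, $t\ge0$, where $\widetilde W$ is the Fourier transform of real Gaussian white noise $W$ (the unique complex-valued random measure with $\int f\,dW=\int\widehat f\,d\widetilde W$ a.s. for all $f\in L^2(\mathbb R)$). The integral $\int_0^TX_s\,dX_s$ is the pathwise (Riemann–Stieltjes/Young-type) integral, the a.s. limit of Riemann sums, which exists since the trajectories are Hölder of order exceeding $1/2$. *)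

theory Defs
  imports "HOL-Probability.Probability"
begin

definition L2fun :: "(real \<Rightarrow> real) \<Rightarrow> bool" where
  "L2fun f \<longleftrightarrow> f \<in> borel_measurable lborel \<and> integrable lborel (\<lambda>x. (f x)\<^sup>2)"

definition white_noise :: "'a measure \<Rightarrow> ((real \<Rightarrow> real) \<Rightarrow> 'a \<Rightarrow> real) \<Rightarrow> bool" where
  "white_noise M W \<longleftrightarrow>
     (\<forall>f. L2fun f \<longrightarrow> W f \<in> borel_measurable M) \<and>
     (\<forall>(n::nat) (c::nat \<Rightarrow> real) fs. (\<forall>i<n. L2fun (fs i)) \<longrightarrow>
        (\<forall>u. char (distr M borel (\<lambda>\<omega>. \<Sum>i<n. c i * W (fs i) \<omega>)) u =
              complex_of_real (exp (- (u\<^sup>2 * (LINT x|lborel. (\<Sum>i<n. c i * fs i x)\<^sup>2) / 2)))))"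

text \<open>Kernel g_t whose Fourier transform (convention hat g(u) = int e^{-iux} g(x) dx)
  is u \<mapsto> (e^{itu}-1)/|u|^{H_t+1/2}; hence the harmonizable integral of that function
  against tilde W equals the white noise integral of g_t.  The imaginary part of the
  inverse transform vanishes by symmetry, so taking Re loses nothing.\<close>
definition mbm_kernel :: "(real \<Rightarrow> real) \<Rightarrow> real \<Rightarrow> real \<Rightarrow> real" where
  "mbm_kernel H t x = Re ((1 / (2 * pi)) *
      (LINT u|lborel. exp (\<i> * complex_of_real (x * u)) * (exp (\<i> * complex_of_real (t * u)) - 1)
                       / complex_of_real (\<bar>u\<bar> powr (H t + 1/2))))"

definition is_mbm :: "'a measure \<Rightarrow> ((real \<Rightarrow> real) \<Rightarrow> 'a \<Rightarrow> real) \<Rightarrow> (real \<Rightarrow> real)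
                       \<Rightarrow> ('a \<Rightarrow> real \<Rightarrow> real) \<Rightarrow> bool" where
  "is_mbm M W H Y \<longleftrightarrow>
     (\<forall>t\<ge>0. AE \<omega> in M. Y \<omega> t = W (mbm_kernel H t) \<omega>) \<and>
     (\<forall>\<omega>\<in>space M. continuous_on {0..} (Y \<omega>))"

definition has_RS_integral :: "(real \<Rightarrow> real) \<Rightarrow> (real \<Rightarrow> real) \<Rightarrow> real \<Rightarrow> real \<Rightarrow> bool" where
  "has_RS_integral f g T L \<longleftrightarrow>
     (\<forall>\<epsilon>>0. \<exists>\<delta>>0. \<forall>(n::nat) (p::nat \<Rightarrow> real) (\<xi>::nat \<Rightarrow> real).
        p 0 = 0 \<and> p n = T \<and> (\<forall>i<n. p i < p (Suc i)) \<and> (\<forall>i<n. p (Suc i) - p i < \<delta>) \<and>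
        (\<forall>i<n. p i \<le> \<xi> i \<and> \<xi> i \<le> p (Suc i)) \<longrightarrow>
        \<bar>(\<Sum>i<n. f (\<xi> i) * (g (p (Suc i)) - g (p i))) - L\<bar> < \<epsilon>)"

definition RS_integral :: "(real \<Rightarrow> real) \<Rightarrow> (real \<Rightarrow> real) \<Rightarrow> real \<Rightarrow> real" where
  "RS_integral f g T = (THE L. has_RS_integral f g T L)"

text \<open>Outer probability (so that convergence in probability does not depend on
  measurability of the events).\<close>
definition outer_prob :: "'a measure \<Rightarrow> 'a set \<Rightarrow> real" where
  "outer_prob M S = Inf {measure M A | A. A \<in> sets M \<and> S \<inter> space M \<subseteq> A}"

definition converges_in_prob :: "'a measure \<Rightarrow> (real \<Rightarrow> 'a \<Rightarrow> real) \<Rightarrow> real \<Rightarrow> bool" where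
  "converges_in_prob M Z c \<longleftrightarrow>
     (\<forall>\<epsilon>>0. ((\<lambda>T. outer_prob M {\<omega>\<in>space M. \<epsilon> < \<bar>Z T \<omega> - c\<bar>}) \<longlongrightarrow> 0) at_top)"

end

theory Submission
  imports Defs
begin

text \<open>Here \<open>X = x0 + Y\<close>, so \<open>\<integral> X dX\<close> over \<open>[0, T]\<close> is \<open>(X\<^sub>T\<^sup>2 - X\<^sub>0\<^sup>2) / 2\<close>, which has order at most
  \<open>T powr (2 * h2)\<close> with \<open>h2 < 1\<close>. By Cauchy--Schwarz the denominator is at least \<open>(\<integral> X)\<^sup>2 / T\<close>, so
  it suffices that \<open>\<integral> X\<close> is of order at least \<open>T powr (3/2)\<close> in probability. Since \<open>H > 1/2\<close>, the
  time-domain kernel is \<open>k (|x| powr (H - 1/2) - |x + t| powr (H - 1/2))\<close> with \<open>k > 0\<close>; it is nonpositive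
  for \<open>x \<ge> 0\<close>, so there is no cancellation between different times \<open>t\<close>, and the Riemann
  sums of \<open>\<integral> Y\<close> are Gaussian with variance at least \<open>c * T ^ 3\<close>. The bounded density of the
  normal distribution turns this into a small ball estimate, which passes to the limit.\<close>

section \<open>Integrable power-type majorants\<close>

text \<open>The exponents at the origin and at infinity are separate, so a single integrable
  function can dominate a whole range of Hurst values. Since \<open>0 powr c = 0\<close> for every
  \<open>c\<close>, the value at the origin is 0, even when \<open>c = 0\<close>.\<close>

definition two_power :: "real \<Rightarrow> real \<Rightarrow> real \<Rightarrow> real" where
  "two_power c a x = (if \<bar>x\<bar> \<le> 1 then \<bar>x\<bar> powr c else \<bar>x\<bar> powr a)"

lemma two_power_nonneg: "0 \<le> two_power c a x"
  by (simp add: two_power_def)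

lemma borel_measurable_two_power [measurable]: "two_power c a \<in> borel_measurable borel"
  unfolding two_power_def by measurable

lemma two_power_mono: "c' \<le> c \<Longrightarrow> a \<le> a' \<Longrightarrow> two_power c a x \<le> two_power c' a' x"
  by (cases "x = 0") (auto simp: two_power_def powr_mono' powr_mono)

lemma integrable_two_power:
  assumes "-1 < c" "a < -1"
  shows "integrable lborel (two_power c a)"
proof -
  have "(\<lambda>x. x powr c) absolutely_integrable_on {0..1}"
    using assms by (intro nonnegative_absolutely_integrable_1 integrable_on_powr_from_0) auto
  then have 1: "integrable lborel (\<lambda>x. indicator {0..1} x * x powr c)"
    unfolding set_integrable_def by (subst (asm) integrable_completion) auto
  have "(\<lambda>x. x powr a) absolutely_integrable_on {1..}"
    using has_integral_powr_to_inf[of a 1] assms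
    by (intro nonnegative_absolutely_integrable_1) (auto simp: integrable_on_def)
  then have 2: "integrable lborel (\<lambda>x. indicator {1..} x * x powr a)"
    unfolding set_integrable_def by (subst (asm) integrable_completion) auto
  \<comment> \<open>\<open>F\<close> lives on the half-line, and adding its reflection covers the
    whole line. Counting the point 1 twice is harmless because \<open>F\<close> only serves as a
    majorant.\<close>
  define F where "F x = indicator {0..1} x * x powr c + indicator {1..} x * x powr a" for x :: real
  have F: "integrable lborel F"
    unfolding F_def using 1 2 by (rule Bochner_Integration.integrable_add)
  have "integrable lborel (\<lambda>x. F x + F (0 + (-1) * x))"
    by (intro Bochner_Integration.integrable_add F lborel_integrable_real_affine) simp
  then show ?thesis
    by (rule Bochner_Integration.integrable_bound)
       (auto simp: F_def two_power_def indicator_def)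
qed

section \<open>Time-domain form of the kernel\<close>

text \<open>This is the constant that scaling leaves in the cosine transform of a power. It
  converges for 1 < \<alpha> < 2 and is never evaluated: the proof uses only bounds from above and
  below that are uniform in \<alpha>.\<close>

definition K_cos :: "real \<Rightarrow> real" where
  "K_cos \<alpha> = (LINT u|lborel. (1 - cos u) * \<bar>u\<bar> powr -\<alpha>)"

lemma norm_exp_i_minus_1_le: "cmod (exp (\<i> * complex_of_real v) - 1) \<le> min 2 \<bar>v\<bar>"
proof -
  have "2 * \<bar>sin (v/2)\<bar> \<le> \<bar>v\<bar>" using abs_sin_x_le_abs_x[of "v/2"] by simp
  moreover have "\<bar>sin (v/2)\<bar> \<le> 1" by simp
  ultimately show ?thesis unfolding dist_exp_i_1 by linarith
qed

lemma one_minus_cos_le: "1 - cos (v::real) \<le> min 2 \<bar>v\<bar>"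
proof -
  have "1 - cos v = Re (1 - exp (\<i> * complex_of_real v))" by (simp add: Re_exp)
  also have "\<dots> \<le> cmod (exp (\<i> * complex_of_real v) - 1)"
    using complex_Re_le_cmod norm_minus_commute by metis
  finally show ?thesis using norm_exp_i_minus_1_le[of v] by simp
qed

text \<open>Here \<open>r\<close> stands for \<open>1 - cos (x * u)\<close> or for the modulus of
  \<open>exp (\<i> * x * u) - 1\<close>. The linear bound is used near the origin and gains one
  power of \<open>u\<close>; the constant bound 2 is used at infinity.\<close>

lemma min_le_two_power:
  fixes r x u \<alpha> :: real
  assumes "0 \<le> r" "r \<le> min 2 \<bar>x * u\<bar>"
  shows "r * \<bar>u\<bar> powr -\<alpha> \<le> (\<bar>x\<bar> + 2) * two_power (1 - \<alpha>) (-\<alpha>) u"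
proof (cases "u = 0")
  case False
  show ?thesis
  proof (cases "\<bar>u\<bar> \<le> 1")
    case True
    have "r * \<bar>u\<bar> powr -\<alpha> \<le> (\<bar>x\<bar> * \<bar>u\<bar>) * \<bar>u\<bar> powr -\<alpha>"
      using assms by (intro mult_right_mono) (auto simp: abs_mult)
    also have "\<dots> = \<bar>x\<bar> * \<bar>u\<bar> powr (1 - \<alpha>)"
      using False by (simp add: powr_diff powr_minus field_simps)
    also have "\<dots> \<le> (\<bar>x\<bar> + 2) * \<bar>u\<bar> powr (1 - \<alpha>)" by (intro mult_right_mono) auto
    finally show ?thesis using True by (simp add: two_power_def)
  next
    case F: False
    have "r * \<bar>u\<bar> powr -\<alpha> \<le> (\<bar>x\<bar> + 2) * \<bar>u\<bar> powr -\<alpha>"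
      using assms by (intro mult_right_mono) auto
    then show ?thesis using F by (simp add: two_power_def)
  qed
qed (simp add: two_power_def)

lemma integrable_one_minus_cos:
  fixes x \<alpha> :: real
  assumes "1 < \<alpha>" "\<alpha> < 2"
  shows "integrable lborel (\<lambda>u. (1 - cos (x * u)) * \<bar>u\<bar> powr -\<alpha>)"
proof (rule Bochner_Integration.integrable_bound)
  show "integrable lborel (\<lambda>u. (\<bar>x\<bar> + 2) * two_power (1 - \<alpha>) (-\<alpha>) u)"
    using assms by (intro integrable_mult_right integrable_two_power) auto
  show "AE u in lborel. norm ((1 - cos (x * u)) * \<bar>u\<bar> powr -\<alpha>)
          \<le> norm ((\<bar>x\<bar> + 2) * two_power (1 - \<alpha>) (-\<alpha>) u)"
    using min_le_two_power[OF _ one_minus_cos_le]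
    by (auto simp: abs_mult two_power_nonneg)
qed auto

text \<open>The substitution of \<open>x * u\<close> for \<open>u\<close> extracts the power of
  \<open>x\<close>. This homogeneity is what produces the explicit kernel.\<close>

lemma integral_one_minus_cos:
  assumes "1 < \<alpha>"
  shows "(LINT u|lborel. (1 - cos (x * u)) * \<bar>u\<bar> powr -\<alpha>) = \<bar>x\<bar> powr (\<alpha> - 1) * K_cos \<alpha>"
proof (cases "x = 0")
  case False
  have "K_cos \<alpha> = \<bar>x\<bar> * (LINT u|lborel. (1 - cos (x * u)) * \<bar>x * u\<bar> powr -\<alpha>)"
    unfolding K_cos_def
    by (subst lborel_integral_real_affine[OF False, where t=0]) simp
  also have "(LINT u|lborel. (1 - cos (x * u)) * \<bar>x * u\<bar> powr -\<alpha>)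
      = (LINT u|lborel. \<bar>x\<bar> powr -\<alpha> * ((1 - cos (x * u)) * \<bar>u\<bar> powr -\<alpha>))"
    by (intro Bochner_Integration.integral_cong) (auto simp: abs_mult powr_mult)
  also have "\<dots> = \<bar>x\<bar> powr -\<alpha> * (LINT u|lborel. (1 - cos (x * u)) * \<bar>u\<bar> powr -\<alpha>)"
    by simp
  finally show ?thesis
    using False by (simp add: powr_diff powr_minus field_simps)
qed simp

text \<open>Only the part of the integral over [1/2, 1] is kept, where the power is at least 1 and
  the cosine at most \<open>cos (1/2)\<close>. The bound does not depend on \<alpha>, which keeps
  the later variance bound uniform in time.\<close>

lemma K_cos_pos_lower:
  assumes "1 < \<alpha>" "\<alpha> < 2"
  shows "(1 - cos (1/2)) / 2 \<le> K_cos \<alpha>"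
proof -
  have "(1 - cos (1/2)) / 2 = (LINT u|lborel. indicator {1/2..1::real} u * (1 - cos (1/2::real)))"
    by simp
  also have "\<dots> \<le> K_cos \<alpha>"
    unfolding K_cos_def
  proof (rule integral_mono)
    show "integrable lborel (\<lambda>u. (1 - cos u) * \<bar>u\<bar> powr -\<alpha>)"
      using integrable_one_minus_cos[OF assms, of 1] by simp
    fix u :: real
    show "indicator {1/2..1} u * (1 - cos (1/2)) \<le> (1 - cos u) * \<bar>u\<bar> powr -\<alpha>"
    proof (cases "u \<in> {1/2..1}")
      case True
      have "cos u \<le> cos (1/2)" using True pi_gt3 by (intro cos_monotone_0_pi_le) auto
      moreover have "1 \<le> \<bar>u\<bar> powr -\<alpha>"
        using True powr_mono'[of "-\<alpha>" 0 u] assms by auto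
      ultimately have "(1 - cos (1/2)) * 1 \<le> (1 - cos u) * \<bar>u\<bar> powr -\<alpha>"
        by (intro mult_mono) auto
      then show ?thesis using True by simp
    qed simp
  next
    have "integrable lborel (indicator {1/2..1::real} :: real \<Rightarrow> real)"
      by (rule integrable_real_indicator) (use emeasure_bounded_finite[of "{1/2..1::real}"] in \<open>auto simp del: emeasure_lborel_Icc\<close>)
    then show "integrable lborel (\<lambda>u. indicator {1/2..1::real} u * (1 - cos (1/2::real)))"
      by (rule integrable_mult_left)
  qed
  finally show ?thesis .
qed

lemma cos_half_less_1: "cos (1/2::real) < 1"
  using cos_monotone_0_pi[of 0 "1/2"] pi_gt3 by simp

text \<open>The integrand is dominated by one envelope for all \<alpha> in \<open>[a, b]\<close>.
  The factor 3 is the \<open>\<bar>x\<bar> + 2\<close> of \<open>min_le_two_power\<close> at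
  \<open>x = 1\<close>.\<close>

lemma K_cos_upper:
  assumes "1 < a" "a \<le> \<alpha>" "\<alpha> \<le> b" "b < 2"
  shows "K_cos \<alpha> \<le> 3 * integral\<^sup>L lborel (two_power (1 - b) (-a))"
proof -
  have "K_cos \<alpha> \<le> (LINT u|lborel. 3 * two_power (1 - b) (-a) u)"
    unfolding K_cos_def
  proof (rule integral_mono)
    show "integrable lborel (\<lambda>u. (1 - cos u) * \<bar>u\<bar> powr -\<alpha>)"
      using integrable_one_minus_cos[of \<alpha> 1] assms by simp
    show "integrable lborel (\<lambda>u. 3 * two_power (1 - b) (-a) u)"
      using assms by (intro integrable_mult_right integrable_two_power) auto
    show "(1 - cos u) * \<bar>u\<bar> powr -\<alpha> \<le> 3 * two_power (1 - b) (-a) u" for u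
      using min_le_two_power[of "1 - cos u" 1 u \<alpha>] one_minus_cos_le[of u]
        two_power_mono[of "1 - b" "1 - \<alpha>" "-\<alpha>" "-a" u] assms
      by auto
  qed
  then show ?thesis by simp
qed

text \<open>The real part of the integrand is a difference of two cosines over a power. The cosines
  alone are not integrable at the origin, but rewriting them through \<open>1 - cos\<close> gives
  two convergent integrals, each computed by scaling. The range 1/2 < H < 1 is exactly 1 < \<alpha>
  < 3/2 for \<alpha> = H + 1/2.\<close>

lemma mbm_kernel_eq:
  assumes "1/2 < H t" "H t < 1"
  shows "mbm_kernel H t x =
    K_cos (H t + 1/2) / (2 * pi) * (\<bar>x\<bar> powr (H t - 1/2) - \<bar>x + t\<bar> powr (H t - 1/2))"
proof -
  define \<alpha> where "\<alpha> = H t + 1/2"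
  have \<alpha>: "1 < \<alpha>" "\<alpha> < 2" using assms by (auto simp: \<alpha>_def)
  define G where "G u = exp (\<i> * complex_of_real (x * u)) * (exp (\<i> * complex_of_real (t * u)) - 1)
                       / complex_of_real (\<bar>u\<bar> powr \<alpha>)" for u
  have G: "integrable lborel G"
  proof (rule Bochner_Integration.integrable_bound)
    show "integrable lborel (\<lambda>u. (\<bar>t\<bar> + 2) * two_power (1 - \<alpha>) (-\<alpha>) u)"
      using \<alpha> by (intro integrable_mult_right integrable_two_power) auto
    show "G \<in> borel_measurable lborel"
      unfolding G_def by measurable
    have "norm (G u) = cmod (exp (\<i> * complex_of_real (t * u)) - 1) * \<bar>u\<bar> powr -\<alpha>" for u
      by (simp add: G_def norm_mult norm_divide norm_inverse powr_minus divide_inverse del: of_real_mult)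
    then show "AE u in lborel. norm (G u) \<le> norm ((\<bar>t\<bar> + 2) * two_power (1 - \<alpha>) (-\<alpha>) u)"
      using min_le_two_power[OF _ norm_exp_i_minus_1_le]
      by (auto simp: two_power_nonneg)
  qed
  have Re_G: "Re (G u) = (1 - cos (x * u)) * \<bar>u\<bar> powr -\<alpha> - (1 - cos ((x + t) * u)) * \<bar>u\<bar> powr -\<alpha>" for u
  proof -
    have "exp (\<i> * complex_of_real (x * u)) * (exp (\<i> * complex_of_real (t * u)) - 1)
        = exp (\<i> * complex_of_real ((x + t) * u)) - exp (\<i> * complex_of_real (x * u))"
      by (simp add: algebra_simps exp_add)
    then have "Re (G u) = (cos ((x + t) * u) - cos (x * u)) / \<bar>u\<bar> powr \<alpha>"
      unfolding G_def by (simp add: Re_exp)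
    then show ?thesis by (simp add: powr_minus divide_inverse algebra_simps)
  qed
  have "mbm_kernel H t x = Re (complex_of_real (1 / (2 * pi)) * integral\<^sup>L lborel G)"
    unfolding mbm_kernel_def G_def \<alpha>_def by simp
  also have "\<dots> = 1 / (2 * pi) * (LINT u|lborel. Re (G u))"
    unfolding integral_Re[OF G] by simp
  also have "(LINT u|lborel. Re (G u)) = \<bar>x\<bar> powr (\<alpha> - 1) * K_cos \<alpha> - \<bar>x + t\<bar> powr (\<alpha> - 1) * K_cos \<alpha>"
    unfolding Re_G using \<alpha>
    by (subst Bochner_Integration.integral_diff)
       (auto simp: integrable_one_minus_cos integral_one_minus_cos)
  finally show ?thesis by (simp add: \<alpha>_def algebra_simps)
qed

section \<open>Square integrability of power increments\<close>

text \<open>Write the first power as \<open>z * z powr (\<beta> - 1)\<close>. Because \<beta> - 1 is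
  negative, replacing \<open>z\<close> by \<open>z - 1\<close> in the second factor increases it, so
  \<open>(z - 1) * z powr (\<beta> - 1)\<close> is at most
  \<open>(z - 1) powr \<beta>\<close>.\<close>

lemma powr_increment_le:
  fixes z \<beta> :: real
  assumes "1 \<le> z" "0 < \<beta>" "\<beta> < 1"
  shows "z powr \<beta> - (z - 1) powr \<beta> \<le> z powr (\<beta> - 1)"
proof (cases "z = 1")
  case False
  have "(z - 1) * z powr (\<beta> - 1) \<le> (z - 1) * (z - 1) powr (\<beta> - 1)"
    using assms False powr_mono2'[of "\<beta> - 1" "z - 1" z] by (intro mult_left_mono) auto
  moreover have "(z - 1) * (z - 1) powr (\<beta> - 1) = (z - 1) powr \<beta>"
    using assms False by (simp add: powr_diff field_simps)
  moreover have "z * z powr (\<beta> - 1) = z powr \<beta>"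
    using assms by (simp add: powr_diff field_simps)
  ultimately show ?thesis by (simp add: algebra_simps)
qed auto

text \<open>The cases follow the signs of \<open>x\<close> and \<open>x + 1\<close>. At
  \<open>x = 0\<close> the increment has modulus 1 while the envelope is
  \<open>0 powr 0 = 0\<close>, so that point is excluded.\<close>

lemma abs_powr_increment_le:
  fixes x \<beta> :: real
  assumes "0 < \<beta>" "\<beta> < 1" "x \<noteq> 0"
  shows "\<bar>\<bar>x\<bar> powr \<beta> - \<bar>x + 1\<bar> powr \<beta>\<bar> \<le> two_power 0 (\<beta> - 1) x"
proof -
  consider "x > 0" | "-1 \<le> x" "x < 0" | "x < -1" using assms by linarith
  then show ?thesis
  proof cases
    case 1
    have "(x + 1) powr \<beta> - x powr \<beta> \<le> (x + 1) powr (\<beta> - 1)"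
      using powr_increment_le[of "x + 1" \<beta>] 1 assms by simp
    moreover have "(x + 1) powr (\<beta> - 1) \<le> two_power 0 (\<beta> - 1) x"
      using 1 assms powr_mono2'[of "\<beta> - 1" x "x+1"] powr_mono2'[of "\<beta> - 1" 1 "x+1"]
      by (auto simp: two_power_def)
    moreover have "x powr \<beta> \<le> (x + 1) powr \<beta>" using 1 assms by (intro powr_mono2) auto
    ultimately show ?thesis using 1 by auto
  next
    case 2
    have "\<bar>x\<bar> powr \<beta> \<le> 1" "\<bar>x+1\<bar> powr \<beta> \<le> 1" using 2 assms by (auto intro!: powr_le1)
    then have "\<bar>\<bar>x\<bar> powr \<beta> - \<bar>x + 1\<bar> powr \<beta>\<bar> \<le> 1"
      using powr_ge_zero[of "\<bar>x\<bar>" \<beta>] powr_ge_zero[of "\<bar>x+1\<bar>" \<beta>] by linarith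
    then show ?thesis using 2 by (auto simp: two_power_def)
  next
    case 3
    have "(-x) powr \<beta> - (-x-1) powr \<beta> \<le> (-x) powr (\<beta> - 1)"
      using powr_increment_le[of "-x" \<beta>] 3 assms by simp
    moreover have "(-x-1) powr \<beta> \<le> (-x) powr \<beta>" using 3 assms by (intro powr_mono2) auto
    moreover have "\<bar>x + 1\<bar> = -x-1" using 3 by simp
    ultimately show ?thesis using 3 by (auto simp: two_power_def)
  qed
qed

lemma two_power_0_square: "x \<noteq> 0 \<Longrightarrow> (two_power 0 a x)\<^sup>2 = two_power 0 (2 * a) x"
  by (auto simp: two_power_def powr_add[symmetric] power2_eq_square)

text \<open>The squared increment decays with exponent \<open>2 * \<beta> - 2\<close>, and b < 1/2
  keeps \<open>2 * b - 2\<close> below -1. Bounding through \<open>b\<close> makes the estimate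
  uniform in \<beta>.\<close>

lemma powr_increment_square_integral:
  assumes "0 < \<beta>" "\<beta> \<le> b" "b < 1/2"
  shows "integrable lborel (\<lambda>x. (\<bar>x\<bar> powr \<beta> - \<bar>x + 1\<bar> powr \<beta>)\<^sup>2)" (is "integrable lborel ?f")
    and "(LINT x|lborel. (\<bar>x\<bar> powr \<beta> - \<bar>x + 1\<bar> powr \<beta>)\<^sup>2) \<le> integral\<^sup>L lborel (two_power 0 (2 * b - 2))"
proof -
  have int: "integrable lborel (two_power 0 (2 * b - 2))"
    using assms by (intro integrable_two_power) auto
  have le: "?f x \<le> two_power 0 (2 * b - 2) x" if "x \<noteq> 0" for x
  proof -
    have "?f x \<le> (two_power 0 (\<beta> - 1) x)\<^sup>2"
      using abs_powr_increment_le[of \<beta> x] that assms two_power_nonneg[of 0 "\<beta>-1" x]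
      by (simp add: abs_le_square_iff[symmetric])
    also have "\<dots> = two_power 0 (2 * \<beta> - 2) x"
      using two_power_0_square[OF that, of "\<beta> - 1"] by (simp add: algebra_simps)
    also have "\<dots> \<le> two_power 0 (2 * b - 2) x"
      using assms by (intro two_power_mono) auto
    finally show ?thesis .
  qed
  have AE: "AE x in lborel. ?f x \<le> two_power 0 (2 * b - 2) x"
    using AE_lborel_singleton[of 0] by eventually_elim (rule le)
  show i: "integrable lborel ?f"
    by (rule Bochner_Integration.integrable_bound[OF int])
       (use AE in \<open>auto simp: two_power_nonneg\<close>)
  show "(LINT x|lborel. ?f x) \<le> integral\<^sup>L lborel (two_power 0 (2 * b - 2))"
    by (rule integral_mono_AE[OF i int AE])
qed

text \<open>Self-similarity: substituting \<open>t * x\<close> for \<open>x\<close> reduces to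
  \<open>t = 1\<close>, with a factor \<open>t powr (2 * \<beta>)\<close> from the square and one
  factor \<open>t\<close> from the Jacobian.\<close>

lemma powr_increment_square_integral_scaled:
  assumes "0 < \<beta>" "\<beta> \<le> b" "b < 1/2" "0 < t"
  shows "integrable lborel (\<lambda>x. (\<bar>x\<bar> powr \<beta> - \<bar>x + t\<bar> powr \<beta>)\<^sup>2)" (is "integrable lborel ?f")
    and "(LINT x|lborel. (\<bar>x\<bar> powr \<beta> - \<bar>x + t\<bar> powr \<beta>)\<^sup>2)
       \<le> t powr (2 * \<beta> + 1) * integral\<^sup>L lborel (two_power 0 (2 * b - 2))"
proof -
  have sc: "?f (0 + t * x) = t powr (2 * \<beta>) * (\<bar>x\<bar> powr \<beta> - \<bar>x + 1\<bar> powr \<beta>)\<^sup>2" for x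
  proof -
    have "t * x + t = t * (x + 1)" by (simp add: algebra_simps)
    then have "\<bar>t * x\<bar> powr \<beta> - \<bar>t * x + t\<bar> powr \<beta> = t powr \<beta> * (\<bar>x\<bar> powr \<beta> - \<bar>x + 1\<bar> powr \<beta>)"
      using assms by (simp only: abs_mult) (simp add: powr_mult right_diff_distrib)
    moreover have "t powr (2 * \<beta>) = (t powr \<beta>)\<^sup>2"
      by (simp add: power2_eq_square powr_add[symmetric])
    ultimately show ?thesis by (simp add: power_mult_distrib)
  qed
  have "integrable lborel (\<lambda>x. ?f (0 + t * x))"
    unfolding sc using assms by (intro integrable_mult_right powr_increment_square_integral(1)[of _ b]) auto
  then show "integrable lborel ?f"
    by (subst (asm) lborel_integrable_real_affine_iff) (use assms in auto)
  have "integral\<^sup>L lborel ?f = t * (LINT x|lborel. ?f (0 + t * x))"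
    using assms by (subst lborel_integral_real_affine[of t _ 0]) auto
  also have "\<dots> = t powr (2 * \<beta> + 1) * (LINT x|lborel. (\<bar>x\<bar> powr \<beta> - \<bar>x + 1\<bar> powr \<beta>)\<^sup>2)"
    unfolding sc using assms by (simp add: powr_add)
  also have "\<dots> \<le> t powr (2 * \<beta> + 1) * integral\<^sup>L lborel (two_power 0 (2 * b - 2))"
    using assms by (intro mult_left_mono powr_increment_square_integral(2)) auto
  finally show "integral\<^sup>L lborel ?f \<le> t powr (2 * \<beta> + 1) * integral\<^sup>L lborel (two_power 0 (2 * b - 2))" .
qed

section \<open>Gaussian laws of white noise integrals\<close>

text \<open>Both sides have the same characteristic function. Writing the normal law as the image of
  the standard one under scaling includes variance 0, which occurs for the kernel at time 0.\<close>

lemma white_noise_combination_distr: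
  assumes "prob_space M" "white_noise M W" "\<And>i. i < (n::nat) \<Longrightarrow> L2fun (fs i)"
  shows "distr M borel (\<lambda>\<omega>. \<Sum>i<n. c i * W (fs i) \<omega>) =
    distr std_normal_distribution borel
      (\<lambda>x. sqrt (LINT x|lborel. (\<Sum>i<n. c i * fs i x)\<^sup>2) * x)" (is "?D = distr _ _ (\<lambda>x. ?s * x)")
proof (rule Levy_uniqueness)
  interpret prob_space M by fact
  interpret N: real_distribution std_normal_distribution by (rule real_dist_normal_dist)
  have [measurable]: "W (fs i) \<in> borel_measurable M" if "i < n" for i
    using assms that by (auto simp: white_noise_def)
  have "prob_space ?D" by (intro prob_space_distr) measurable
  then show "real_distribution ?D"
    by (auto simp: real_distribution_def real_distribution_axioms_def)
  show "real_distribution (distr std_normal_distribution borel (\<lambda>x. ?s * x))"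
    by (intro N.real_distribution_distr) measurable
  show "char ?D = char (distr std_normal_distribution borel (\<lambda>x. ?s * x))"
  proof
    fix u
    have "char (distr std_normal_distribution borel (\<lambda>x. ?s * x)) u = char std_normal_distribution (?s * u)"
      unfolding char_def by (subst integral_distr) (auto simp: ac_simps)
    moreover have "?s\<^sup>2 = (LINT x|lborel. (\<Sum>i<n. c i * fs i x)\<^sup>2)"
      by (intro real_sqrt_pow2 Bochner_Integration.integral_nonneg) auto
    ultimately have "char (distr std_normal_distribution borel (\<lambda>x. ?s * x)) u
        = complex_of_real (exp (- (u\<^sup>2 * (LINT x|lborel. (\<Sum>i<n. c i * fs i x)\<^sup>2) / 2)))"
      unfolding char_std_normal_distribution by (simp only: power_mult_distrib) (simp add: mult.commute)
    then show "char ?D u = char (distr std_normal_distribution borel (\<lambda>x. ?s * x)) u"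
      using assms by (simp add: white_noise_def)
  qed
qed

lemma (in prob_space) measure_scaled_normal:
  assumes S [measurable]: "S \<in> borel_measurable M"
    and "distr M borel S = distr std_normal_distribution borel (\<lambda>x. \<sigma> * x)"
    and B [measurable]: "B \<in> sets borel"
  shows "measure M {\<omega>\<in>space M. S \<omega> \<in> B} = measure std_normal_distribution {x. \<sigma> * x \<in> B}"
proof -
  have "measure M {\<omega>\<in>space M. S \<omega> \<in> B} = measure (distr M borel S) B"
    by (subst measure_distr) (auto intro!: arg_cong[where f="measure M"])
  also have "\<dots> = measure std_normal_distribution {x. \<sigma> * x \<in> B}"
    unfolding assms(2)
    by (subst measure_distr) (auto intro!: arg_cong[where f="measure std_normal_distribution"])
  finally show ?thesis .
qed

text \<open>The bound depends only on \<open>l\<close>, so one quantile serves all times once an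
  upper bound \<open>s\<close> for the standard deviation is known.\<close>

lemma (in prob_space) normal_tail_le:
  assumes "S \<in> borel_measurable M"
    and "distr M borel S = distr std_normal_distribution borel (\<lambda>x. \<sigma> * x)"
    and "0 \<le> \<sigma>" "\<sigma> \<le> s" "0 \<le> l"
  shows "measure M {\<omega>\<in>space M. s * l < \<bar>S \<omega>\<bar>} \<le> measure std_normal_distribution {x. l < \<bar>x\<bar>}"
proof -
  interpret N: real_distribution std_normal_distribution by (rule real_dist_normal_dist)
  have "measure M {\<omega>\<in>space M. s * l < \<bar>S \<omega>\<bar>} = measure std_normal_distribution {x. s * l < \<bar>\<sigma> * x\<bar>}"
    using measure_scaled_normal[OF assms(1,2), of "{y. s * l < \<bar>y\<bar>}"] by simp
  also have "\<dots> \<le> measure std_normal_distribution {x. l < \<bar>x\<bar>}"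
  proof (rule N.finite_measure_mono)
    show "{x. s * l < \<bar>\<sigma> * x\<bar>} \<subseteq> {x. l < \<bar>x\<bar>}"
    proof safe
      fix x assume "s * l < \<bar>\<sigma> * x\<bar>"
      moreover have "\<bar>\<sigma> * x\<bar> \<le> s * \<bar>x\<bar>"
        using assms by (auto simp: abs_mult intro!: mult_right_mono)
      ultimately have "s * l < s * \<bar>x\<bar>" by linarith
      then show "l < \<bar>x\<bar>" using assms by (simp add: mult_less_cancel_left)
    qed
  qed simp
  finally show ?thesis .
qed

lemma normal_tail_tendsto_0:
  "(\<lambda>n. measure std_normal_distribution {x. real n < \<bar>x\<bar>}) \<longlonglongrightarrow> 0"
proof -
  interpret N: real_distribution std_normal_distribution by (rule real_dist_normal_dist)
  have "(\<lambda>n. measure std_normal_distribution {x. real n < \<bar>x\<bar>})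
      \<longlonglongrightarrow> measure std_normal_distribution (\<Inter>n. {x. real n < \<bar>x\<bar>})"
    by (rule N.finite_Lim_measure_decseq) (auto simp: decseq_def)
  moreover have "(\<Inter>n. {x::real. real n < \<bar>x\<bar>}) = {}"
    using reals_Archimedean2 by (auto simp: set_eq_iff not_less intro: less_imp_le)
  ultimately show ?thesis by simp
qed

text \<open>The standard normal density is at most 1 and the event confines the standard variable to
  an interval of length \<open>2 * a / \<sigma>\<close>. The shift \<open>m\<close> will be the
  contribution of the starting point \<open>x0\<close>.\<close>

lemma (in prob_space) normal_small_ball_le:
  assumes "S \<in> borel_measurable M"
    and "distr M borel S = distr std_normal_distribution borel (\<lambda>x. \<sigma> * x)"
    and "0 < \<sigma>" "0 \<le> a"
  shows "measure M {\<omega>\<in>space M. \<bar>m + S \<omega>\<bar> < a} \<le> 2 * a / \<sigma>"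
proof -
  let ?I = "{(-a - m) / \<sigma>..(a - m) / \<sigma>}"
  interpret N: real_distribution std_normal_distribution by (rule real_dist_normal_dist)
  have "measure M {\<omega>\<in>space M. \<bar>m + S \<omega>\<bar> < a} = measure std_normal_distribution {x. \<bar>m + \<sigma> * x\<bar> < a}"
    using measure_scaled_normal[OF assms(1,2), of "{y. \<bar>m + y\<bar> < a}"] by simp
  also have "\<dots> \<le> measure std_normal_distribution ?I"
    using assms by (intro N.finite_measure_mono) (auto simp: field_simps abs_less_iff)
  also have "\<dots> = enn2real (emeasure std_normal_distribution ?I)"
    by (simp add: measure_def)
  also have "emeasure std_normal_distribution ?I \<le> ennreal (2 * a / \<sigma>)"
  proof -
    have "std_normal_density x \<le> 1" for x
    proof -
      have "1 \<le> sqrt (2 * pi)" using pi_gt3 by simp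
      then have "1 / sqrt (2 * pi) * exp (- x\<^sup>2 / 2) \<le> 1 * 1"
        by (intro mult_mono) auto
      then show ?thesis by (simp add: std_normal_density_def)
    qed
    then have "emeasure std_normal_distribution ?I \<le> (\<integral>\<^sup>+x. indicator ?I x \<partial>lborel)"
      by (subst emeasure_density)
         (auto intro!: nn_integral_mono simp del: nn_integral_indicator split: split_indicator)
    also have "\<dots> = ennreal (2 * a / \<sigma>)"
      using assms by (simp add: field_simps)
    finally show ?thesis .
  qed
  then have "enn2real (emeasure std_normal_distribution ?I) \<le> 2 * a / \<sigma>"
    using assms by (intro enn2real_leI) auto
  finally show ?thesis .
qed

section \<open>Pathwise integrals: Riemann--Stieltjes, Riemann sums, Cauchy--Schwarz\<close>

text \<open>Averaging the Riemann sums with left and with right tags makes them telescope.\<close>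

lemma has_RS_integral_self:
  assumes "has_RS_integral X X T L" "0 < T"
  shows "L = ((X T)\<^sup>2 - (X 0)\<^sup>2) / 2"
proof -
  have "\<bar>((X T)\<^sup>2 - (X 0)\<^sup>2) / 2 - L\<bar> \<le> \<epsilon>" if eps: "\<epsilon> > 0" for \<epsilon>
  proof -
    obtain \<delta> where d: "\<delta> > 0 \<and> (\<forall>(n::nat) p \<xi>.
        p 0 = 0 \<and> p n = T \<and> (\<forall>i<n. p i < p (Suc i)) \<and> (\<forall>i<n. p (Suc i) - p i < \<delta>) \<and>
        (\<forall>i<n. p i \<le> \<xi> i \<and> \<xi> i \<le> p (Suc i)) \<longrightarrow>
        \<bar>(\<Sum>i<n. X (\<xi> i) * (X (p (Suc i)) - X (p i))) - L\<bar> < \<epsilon>)"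
      using assms(1)[unfolded has_RS_integral_def, THEN spec, THEN mp, OF eps] by (rule exE)
    note \<delta> = d[THEN conjunct1]
    note R = d[THEN conjunct2, THEN spec, THEN spec, THEN spec, THEN mp]
    obtain n :: nat where n: "T / \<delta> < real n" using reals_Archimedean2 by blast
    then have n0: "0 < real n" using assms(2) \<delta> by (meson divide_pos_pos less_trans)
    define p where "p i = real i * T / real n" for i
    have p: "p 0 = 0" "p n = T" "\<forall>i<n. p i < p (Suc i)" "\<forall>i<n. p (Suc i) - p i < \<delta>"
      using n n0 assms(2) \<delta> by (auto simp: p_def field_simps)
    define l where "l = (\<Sum>i<n. X (p i) * (X (p (Suc i)) - X (p i)))"
    define r where "r = (\<Sum>i<n. X (p (Suc i)) * (X (p (Suc i)) - X (p i)))"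
    have "\<bar>l - L\<bar> < \<epsilon>" unfolding l_def by (rule R) (use p in \<open>auto simp: less_imp_le\<close>)
    moreover have "\<bar>r - L\<bar> < \<epsilon>" unfolding r_def
      by (rule R) (use p in \<open>auto simp: less_imp_le\<close>)
    moreover have "(X T)\<^sup>2 - (X 0)\<^sup>2 = l + r"
    proof -
      have "l + r = (\<Sum>i<n. (X (p (Suc i)))\<^sup>2 - (X (p i))\<^sup>2)"
        by (simp add: l_def r_def sum.distrib[symmetric] power2_eq_square algebra_simps)
      also have "\<dots> = (X (p n))\<^sup>2 - (X (p 0))\<^sup>2" by (rule sum_lessThan_telescope)
      finally show ?thesis by (simp add: p)
    qed
    ultimately show ?thesis by (simp only: abs_le_iff abs_less_iff) (simp add: field_simps)
  qed
  then have "\<bar>((X T)\<^sup>2 - (X 0)\<^sup>2) / 2 - L\<bar> \<le> 0"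
    by (rule field_le_epsilon[where y=0, simplified])
  then show ?thesis by simp
qed

text \<open>If the Riemann--Stieltjes integral does not exist, \<^const>\<open>RS_integral\<close> is the
  unspecified but fixed real number \<open>THE L. False\<close>; hence the regularity of the paths is irrelevant.\<close>

lemma abs_RS_integral_self_le:
  assumes "0 < T"
  shows "\<bar>RS_integral X X T\<bar> \<le> \<bar>THE L. False\<bar> + ((X T)\<^sup>2 + (X 0)\<^sup>2) / 2"
proof (cases "\<exists>L. has_RS_integral X X T L")
  case True
  then obtain L where L: "has_RS_integral X X T L" by blast
  have "RS_integral X X T = ((X T)\<^sup>2 - (X 0)\<^sup>2) / 2"
    unfolding RS_integral_def
  proof (rule the_equality)
    show "has_RS_integral X X T (((X T)\<^sup>2 - (X 0)\<^sup>2) / 2)"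
      using L has_RS_integral_self[OF L assms] by simp
  qed (rule has_RS_integral_self[OF _ assms])
  then have "\<bar>RS_integral X X T\<bar> \<le> ((X T)\<^sup>2 + (X 0)\<^sup>2) / 2"
    using zero_le_power2[of "X T"] zero_le_power2[of "X 0"] unfolding abs_le_iff by (simp del: zero_le_power2)
  then show ?thesis by linarith
next
  case False
  then have "has_RS_integral X X T = (\<lambda>L. False)" by auto
  then have "RS_integral X X T = (THE L. False)"
    unfolding RS_integral_def by (rule arg_cong)
  then show ?thesis by (simp add: add_nonneg_nonneg)
qed

text \<open>By uniform continuity each of the \<open>n\<close> cells contributes an error of at most
  \<open>e * T / n\<close>. The lemma exhibits the path integral as a limit of finite combinations,
  whose laws are known.\<close>

lemma Riemann_sum_tendsto:
  fixes f :: "real \<Rightarrow> real"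
  assumes f: "continuous_on {0..T} f" and T: "0 < T"
  shows "(\<lambda>n. \<Sum>i<n. T / real n * f (real i * T / real n)) \<longlonglongrightarrow> integral {0..T} f"
proof (rule LIMSEQ_I)
  fix r :: real assume r: "0 < r"
  \<comment> \<open>The total error is then at most \<open>e * T = r / 2\<close>, which leaves room
    for the strict inequality.\<close>
  define e where "e = r / (2 * T)"
  have e: "0 < e" using r T by (simp add: e_def)
  have "uniformly_continuous_on {0..T} f"
    using f by (intro compact_uniformly_continuous) auto
  then obtain d where d: "d > 0" and dd: "\<And>x y. x \<in> {0..T} \<Longrightarrow> y \<in> {0..T} \<Longrightarrow> dist y x < d \<Longrightarrow> dist (f y) (f x) < e"
    using e unfolding uniformly_continuous_on_def by metis
  obtain N :: nat where N: "T / d < real N" using reals_Archimedean2 by blast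
  show "\<exists>no. \<forall>n\<ge>no. norm ((\<Sum>i<n. T / real n * f (real i * T / real n)) - integral {0..T} f) < r"
  proof (intro exI allI impI)
    fix n assume "n \<ge> N"
    then have n: "T / d < real n" using N by linarith
    then have n0: "0 < real n" using T d by (meson divide_pos_pos less_trans)
    define p where "p i = real i * T / real n" for i
    have step: "p (Suc i) - p i = T / real n" for i
      by (simp add: p_def diff_divide_distrib[symmetric]) (simp add: algebra_simps)
    have mesh: "T / real n < d" using n n0 d by (simp add: field_simps)
    have p0: "0 \<le> p i" for i using T by (simp add: p_def)
    have pT: "p i \<le> T" if "i \<le> n" for i
      using that T n0 by (simp add: p_def field_simps)
    have pmono: "p i \<le> p (Suc i)" for i
      using step[of i] T n0 divide_pos_pos[of T "real n"] by linarith
    have int: "f integrable_on {a..b}" if "0 \<le> a" "b \<le> T" for a b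
      using that by (intro integrable_continuous_interval continuous_on_subset[OF f]) auto
    have split: "integral {0..p k} f = (\<Sum>i<k. integral {p i..p (Suc i)} f)" if "k \<le> n" for k
      using that
    proof (induction k)
      case (Suc k)
      have "integral {0..p k} f + integral {p k..p (Suc k)} f = integral {0..p (Suc k)} f"
        by (intro Henstock_Kurzweil_Integration.integral_combine p0 pmono int pT) (use Suc in auto)
      with Suc show ?case by simp
    qed (simp add: p_def)
    have "\<bar>T / real n * f (p i) - integral {p i..p (Suc i)} f\<bar> \<le> e * (T / real n)" if "i < n" for i
    proof -
      have sub: "{p i..p (Suc i)} \<subseteq> {0..T}" using p0[of i] pT[of "Suc i"] that by auto
      have "((\<lambda>x. f (p i)) has_integral (T / real n * f (p i))) {p i..p (Suc i)}"
        using has_integral_const_real[of "f (p i)" "p i" "p (Suc i)"] pmono[of i] step[of i] by simp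
      moreover have "(f has_integral integral {p i..p (Suc i)} f) {p i..p (Suc i)}"
        using int[of "p i" "p (Suc i)"] p0 pT that by (intro integrable_integral) auto
      ultimately have "((\<lambda>x. f (p i) - f x) has_integral
          (T / real n * f (p i) - integral {p i..p (Suc i)} f)) (cbox (p i) (p (Suc i)))"
        unfolding cbox_interval by (rule has_integral_diff)
      then have "norm (T / real n * f (p i) - integral {p i..p (Suc i)} f) \<le> e * measure lborel (cbox (p i) (p (Suc i)))"
      proof (rule has_integral_bound[rotated])
        fix x assume x: "x \<in> cbox (p i) (p (Suc i))"
        have "dist (p i) x < d" using x step[of i] mesh by (auto simp: dist_real_def)
        then have "dist (f (p i)) (f x) < e" using x sub pmono[of i] by (intro dd) auto
        then show "norm (f (p i) - f x) \<le> e" by (simp add: dist_norm)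
      qed (use e in auto)
      then show ?thesis using pmono[of i] step[of i] by simp
    qed
    then have "(\<Sum>i<n. \<bar>T / real n * f (p i) - integral {p i..p (Suc i)} f\<bar>) \<le> (\<Sum>i<n. e * (T / real n))"
      by (intro sum_mono) auto
    then have "\<bar>\<Sum>i<n. T / real n * f (p i) - integral {p i..p (Suc i)} f\<bar> \<le> (\<Sum>i<n. e * (T / real n))"
      by (rule order_trans[OF sum_abs])
    also have "\<dots> = r / 2" using n0 T by (simp add: e_def)
    also have "\<dots> < r" using r by simp
    also have "(\<Sum>i<n. T / real n * f (p i) - integral {p i..p (Suc i)} f)
        = (\<Sum>i<n. T / real n * f (p i)) - integral {0..p n} f"
      by (simp only: sum_subtractf split order_refl)
    also have "p n = T" using n0 by (simp add: p_def)
    finally show "norm ((\<Sum>i<n. T / real n * f (real i * T / real n)) - integral {0..T} f) < r"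
      by (simp add: p_def)
  qed
qed

text \<open>Cauchy--Schwarz against the constant 1, obtained by integrating the square of
  \<open>f\<close> minus its mean \<open>I / T\<close>.\<close>

lemma integral_square_ge:
  fixes f :: "real \<Rightarrow> real"
  assumes "continuous_on {0..T} f" "0 < T"
  shows "(integral {0..T} f)\<^sup>2 \<le> T * integral {0..T} (\<lambda>x. (f x)\<^sup>2)"
proof -
  define I where "I = integral {0..T} f"
  define Q where "Q = integral {0..T} (\<lambda>x. (f x)\<^sup>2)"
  have f: "(f has_integral I) {0..T}"
    unfolding I_def using assms by (intro integrable_integral integrable_continuous_interval)
  have q: "((\<lambda>x. (f x)\<^sup>2) has_integral Q) {0..T}"
    unfolding Q_def using assms
    by (intro integrable_integral integrable_continuous_interval continuous_intros)
  have c: "((\<lambda>x. (I / T)\<^sup>2) has_integral (T * (I / T)\<^sup>2)) {0..T}"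
    using has_integral_const_real[of "(I / T)\<^sup>2" 0 T] assms by simp
  have "((\<lambda>x. (f x)\<^sup>2 - 2 * (I / T) * f x + (I / T)\<^sup>2) has_integral
      (Q - 2 * (I / T) * I + T * (I / T)\<^sup>2)) {0..T}"
    by (intro has_integral_add has_integral_diff has_integral_mult_right f q c)
  then have "0 \<le> Q - 2 * (I / T) * I + T * (I / T)\<^sup>2"
  proof (rule has_integral_nonneg)
    have "0 \<le> a\<^sup>2 - 2 * b * a + b\<^sup>2" for a b :: real
      using sum_squares_ge_zero[of "a - b" 0] by (simp add: algebra_simps power2_eq_square)
    then show "0 \<le> (f x)\<^sup>2 - 2 * (I / T) * f x + (I / T)\<^sup>2" for x .
  qed
  also have "\<dots> = Q - I\<^sup>2 / T" using assms by (simp add: power2_eq_square field_simps)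
  finally show ?thesis using assms unfolding I_def[symmetric] Q_def[symmetric]
    by (simp add: field_simps)
qed

section \<open>Variance bounds for the process and for its Riemann sums\<close>

lemma L2fun_mbm_kernel:
  assumes "0 \<le> t" "1/2 < H t" "H t < 1"
  shows "L2fun (mbm_kernel H t)"
proof (cases "t = 0")
  case True
  then have "mbm_kernel H t = (\<lambda>x. 0)"
    using mbm_kernel_eq[of H t] assms by auto
  then show ?thesis by (simp add: L2fun_def)
next
  case False
  define k where "k = K_cos (H t + 1/2) / (2 * pi)"
  have "integrable lborel (\<lambda>x. k\<^sup>2 * (\<bar>x\<bar> powr (H t - 1/2) - \<bar>x + t\<bar> powr (H t - 1/2))\<^sup>2)"
    using assms False
    by (intro integrable_mult_right powr_increment_square_integral_scaled(1)[of _ "H t - 1/2"]) auto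
  moreover have "mbm_kernel H t = (\<lambda>x. k * (\<bar>x\<bar> powr (H t - 1/2) - \<bar>x + t\<bar> powr (H t - 1/2)))"
    using mbm_kernel_eq[of H t] assms by (auto simp: k_def)
  ultimately show ?thesis by (simp add: L2fun_def power_mult_distrib)
qed

lemma L2fun_add:
  assumes "L2fun f" "L2fun g"
  shows "L2fun (\<lambda>x. f x + g x)"
  unfolding L2fun_def
proof
  have [measurable]: "f \<in> borel_measurable lborel" "g \<in> borel_measurable lborel"
    and int: "integrable lborel (\<lambda>x. 2 * (f x)\<^sup>2 + 2 * (g x)\<^sup>2)"
    using assms by (auto simp: L2fun_def)
  show "(\<lambda>x. f x + g x) \<in> borel_measurable lborel" by measurable
  show "integrable lborel (\<lambda>x. (f x + g x)\<^sup>2)"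
  proof (rule Bochner_Integration.integrable_bound[OF int])
    have "(f x + g x)\<^sup>2 \<le> 2 * (f x)\<^sup>2 + 2 * (g x)\<^sup>2" for x
      using zero_le_power2[of "f x - g x"] by (simp add: power2_diff power2_sum)
    then show "AE x in lborel. norm ((f x + g x)\<^sup>2) \<le> norm (2 * (f x)\<^sup>2 + 2 * (g x)\<^sup>2)" by auto
  qed measurable
qed

lemma L2fun_combination:
  fixes n :: nat
  assumes "\<And>i. i < n \<Longrightarrow> L2fun (fs i)"
  shows "L2fun (\<lambda>x. \<Sum>i<n. c i * fs i x)"
  using assms
proof (induction n)
  case (Suc n)
  have "L2fun (\<lambda>x. c n * fs n x)"
    using Suc.prems[of n] by (auto simp: L2fun_def power_mult_distrib intro!: borel_measurable_times)
  then show ?case using L2fun_add[OF Suc.IH] Suc.prems by simp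
qed (simp add: L2fun_def)

lemma K_cos_nonneg: "1 < \<alpha> \<Longrightarrow> \<alpha> < 2 \<Longrightarrow> 0 \<le> K_cos \<alpha>"
  using K_cos_pos_lower[of \<alpha>] cos_half_less_1 by simp

text \<open>The variance at time \<open>t\<close> is of order \<open>t powr (2 * H t)\<close>; for t
  \<ge> 1 this is at most \<open>t powr (2 * h2)\<close>. The constant depends on \<open>h1\<close>
  and \<open>h2\<close> only.\<close>

lemma mbm_kernel_variance_le:
  assumes h: "1/2 < h1" "h2 < 1"
  shows "\<exists>C\<ge>0. \<forall>H t. 1 \<le> t \<longrightarrow> h1 \<le> H t \<longrightarrow> H t \<le> h2 \<longrightarrow>
    (LINT x|lborel. (mbm_kernel H t x)\<^sup>2) \<le> C * t powr (2 * h2)"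
proof -
  define K where "K = 3 * integral\<^sup>L lborel (two_power (1 - (h2 + 1/2)) (-(h1 + 1/2))) / (2 * pi)"
  define I where "I = integral\<^sup>L lborel (two_power 0 (2 * (h2 - 1/2) - 2))"
  have I: "0 \<le> I" unfolding I_def
    by (intro Bochner_Integration.integral_nonneg two_power_nonneg)
  have "(LINT x|lborel. (mbm_kernel H t x)\<^sup>2) \<le> (K\<^sup>2 * I) * t powr (2 * h2)"
    if t: "1 \<le> t" and Ht: "h1 \<le> H t" "H t \<le> h2" for H t
  proof -
    define k where "k = K_cos (H t + 1/2) / (2 * pi)"
    have k: "0 \<le> k" "k \<le> K"
      using K_cos_nonneg[of "H t + 1/2"] K_cos_upper[of "h1 + 1/2" "H t + 1/2" "h2 + 1/2"] h Ht
      by (auto simp: k_def K_def intro!: divide_right_mono)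
    have "(LINT x|lborel. (mbm_kernel H t x)\<^sup>2)
        = (LINT x|lborel. k\<^sup>2 * (\<bar>x\<bar> powr (H t - 1/2) - \<bar>x + t\<bar> powr (H t - 1/2))\<^sup>2)"
      using h Ht by (simp only: mbm_kernel_eq[of H t, OF less_le_trans le_less_trans] k_def[symmetric] power_mult_distrib)
    also have "\<dots> = k\<^sup>2 * (LINT x|lborel. (\<bar>x\<bar> powr (H t - 1/2) - \<bar>x + t\<bar> powr (H t - 1/2))\<^sup>2)"
      by simp
    also have "\<dots> \<le> k\<^sup>2 * (t powr (2 * (H t - 1/2) + 1) * I)"
      unfolding I_def using h Ht t
      by (intro mult_left_mono powr_increment_square_integral_scaled(2)) auto
    also have "\<dots> \<le> K\<^sup>2 * (t powr (2 * h2) * I)"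
      using k t Ht I by (intro mult_mono power_mono powr_mono) auto
    finally show ?thesis by (simp add: mult_ac)
  qed
  moreover have "0 \<le> K\<^sup>2 * I" using I by simp
  ultimately show ?thesis by blast
qed

text \<open>This common sign on the half-line is what excludes cancellation when kernels at
  different times are added.\<close>

lemma mbm_kernel_nonpos:
  assumes "1/2 < H s" "H s < 1" "0 \<le> s" "0 \<le> x"
  shows "mbm_kernel H s x \<le> 0"
proof -
  have "x powr (H s - 1/2) \<le> (x + s) powr (H s - 1/2)"
    using assms by (intro powr_mono2) auto
  then show ?thesis
    using assms K_cos_nonneg[of "H s + 1/2"]
    by (auto simp: mbm_kernel_eq intro!: mult_nonneg_nonpos divide_nonpos_pos)
qed

text \<open>From x \<le> T and T/2 \<le> s the ratio \<open>s / x\<close> is at least 1/2. Factoring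
  out \<open>x powr \<beta>\<close>, which is at least 1, leaves
  \<open>(1 + s / x) powr \<beta> - 1\<close>, hence the base 3/2.\<close>

lemma mbm_kernel_le:
  assumes h: "1/2 < h1" "h2 < 1" and "h1 \<le> H s" "H s \<le> h2"
    and "1 \<le> x" "x \<le> T" "T / 2 \<le> s"
  shows "mbm_kernel H s x \<le> - ((1 - cos (1/2)) / (4 * pi) * ((3/2) powr (h1 - 1/2) - 1))"
proof -
  define \<beta> where "\<beta> = H s - 1/2"
  define \<gamma> where "\<gamma> = (3/2::real) powr (h1 - 1/2) - 1"
  have \<beta>: "h1 - 1/2 \<le> \<beta>" "0 < \<beta>" using assms by (auto simp: \<beta>_def)
  have \<gamma>: "0 \<le> \<gamma>" using h ge_one_powr_ge_zero[of "3/2" "h1 - 1/2"] by (simp add: \<gamma>_def)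
  have s: "0 \<le> s" using assms by simp
  have "\<gamma> \<le> (3/2) powr \<beta> - 1"
    using \<beta> by (auto simp: \<gamma>_def intro!: powr_mono)
  also have "\<dots> \<le> (1 + s / x) powr \<beta> - 1"
    using assms \<beta> by (auto simp: field_simps intro!: powr_mono2)
  also have "\<dots> \<le> x powr \<beta> * ((1 + s / x) powr \<beta> - 1)"
  proof -
    have "1 \<le> x powr \<beta>" using assms \<beta> by (intro ge_one_powr_ge_zero) auto
    moreover have "1 \<le> (1 + s / x) powr \<beta>" using assms s \<beta> by (intro ge_one_powr_ge_zero) auto
    ultimately show ?thesis by (simp add: mult_le_cancel_right1)
  qed
  also have "\<dots> = (x + s) powr \<beta> - x powr \<beta>"
  proof -
    have "x + s = x * (1 + s / x)" using assms by (simp add: field_simps)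
    then show ?thesis using assms s by (simp add: powr_mult right_diff_distrib)
  qed
  finally have inc: "\<gamma> \<le> (x + s) powr \<beta> - x powr \<beta>" .
  have "(1 - cos (1/2)) / (4 * pi) * \<gamma>
      \<le> K_cos (H s + 1/2) / (2 * pi) * ((x + s) powr \<beta> - x powr \<beta>)"
  proof (rule mult_mono)
    show "(1 - cos (1/2)) / (4 * pi) \<le> K_cos (H s + 1/2) / (2 * pi)"
      using divide_right_mono[OF K_cos_pos_lower[of "H s + 1/2"], of "2 * pi"] assms by simp
    show "0 \<le> K_cos (H s + 1/2) / (2 * pi)"
      using K_cos_nonneg[of "H s + 1/2"] assms by simp
  qed (use inc \<gamma> in auto)
  also have "\<dots> = - mbm_kernel H s x"
    using assms s by (simp add: mbm_kernel_eq \<beta>_def algebra_simps)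
  finally show ?thesis by (simp add: \<gamma>_def)
qed

text \<open>The space integral is restricted to \<open>[1, T]\<close> and the sum to its second
  half, the times from \<open>T / 2\<close> on. An even number of cells gives that half exactly
  \<open>m\<close> terms, each at most \<open>- c * T / (2 * m)\<close>, so the sum is at most
  \<open>- c * T / 2\<close> there.\<close>

lemma Riemann_sum_variance_ge:
  assumes h: "1/2 < h1" "h2 < 1"
  shows "\<exists>c>0. \<forall>H T m. (\<forall>t\<ge>0. h1 \<le> H t \<and> H t \<le> h2) \<longrightarrow> 2 \<le> T \<longrightarrow> 0 < m \<longrightarrow> c * T ^ 3 \<le>
    (LINT x|lborel. (\<Sum>i<2 * m. T / real (2 * m) * mbm_kernel H (real i * T / real (2 * m)) x)\<^sup>2)"
proof -
  define c where "c = (1 - cos (1/2)) / (4 * pi) * ((3/2::real) powr (h1 - 1/2) - 1)"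
  have c: "0 < c"
    using h cos_half_less_1 powr_less_mono[of 0 "h1 - 1/2" "3/2::real"] by (auto simp: c_def)
  have "c\<^sup>2 / 8 * T ^ 3 \<le>
      (LINT x|lborel. (\<Sum>i<2 * m. T / real (2 * m) * mbm_kernel H (real i * T / real (2 * m)) x)\<^sup>2)"
    (is "_ \<le> (LINT x|lborel. (?S x)\<^sup>2)")
    if H: "\<forall>t\<ge>0. h1 \<le> H t \<and> H t \<le> h2" and T: "2 \<le> T" and m: "0 < m" for H T and m :: nat
  proof -
    have H': "1/2 < H t" "H t < 1" if "0 \<le> t" for t using H[rule_format, OF that] h by auto
    have t0: "0 \<le> real i * T / real (2 * m)" for i using T by simp
    have S: "L2fun ?S"
      by (intro L2fun_combination L2fun_mbm_kernel t0 H')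
    have "c\<^sup>2 / 8 * T ^ 3 = (c * T / 2)\<^sup>2 * (T / 2)"
      by (simp add: power2_eq_square power3_eq_cube)
    \<comment> \<open>T \<ge> 2 gives T/2 \<le> T - 1, the length of \<open>[1, T]\<close>.\<close>
    also have "\<dots> \<le> (c * T / 2)\<^sup>2 * (T - 1)"
      using T by (intro mult_left_mono) auto
    also have "\<dots> = (LINT x|lborel. indicator {1..T} x * (c * T / 2)\<^sup>2)"
      using T by simp
    also have "\<dots> \<le> (LINT x|lborel. (?S x)\<^sup>2)"
    proof (rule integral_mono)
      show "integrable lborel (\<lambda>x. (?S x)\<^sup>2)" using S by (simp add: L2fun_def)
      have "integrable lborel (indicator {1..T} :: real \<Rightarrow> real)"
        by (rule integrable_real_indicator)
           (use emeasure_bounded_finite[of "{1..T}"] in \<open>auto simp del: emeasure_lborel_Icc\<close>)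
      then show "integrable lborel (\<lambda>x. indicator {1..T} x * (c * T / 2)\<^sup>2)"
        by (rule integrable_mult_left)
      fix x :: real
      show "indicator {1..T} x * (c * T / 2)\<^sup>2 \<le> (?S x)\<^sup>2"
      proof (cases "x \<in> {1..T}")
        case True
        have "c * T / 2 = (\<Sum>i\<in>{m..<2 * m}. T / real (2 * m) * c)"
          using m by (simp add: field_simps)
        also have "\<dots> \<le> (\<Sum>i\<in>{m..<2 * m}. T / real (2 * m) * - mbm_kernel H (real i * T / real (2 * m)) x)"
        proof (intro sum_mono mult_left_mono)
          fix i assume i: "i \<in> {m..<2 * m}"
          have "T * real m \<le> T * real i" using i T by (intro mult_left_mono) auto
          then have "T / 2 \<le> real i * T / real (2 * m)" using m by (simp add: field_simps)
          then have "mbm_kernel H (real i * T / real (2 * m)) x \<le> - c"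
            unfolding c_def using True H t0
            by (intro mbm_kernel_le[OF h, where T=T]) auto
          then show "c \<le> - mbm_kernel H (real i * T / real (2 * m)) x" by simp
        qed (use T in auto)
        \<comment> \<open>The terms of the first half are added back; they have the same
          sign.\<close>
        also have "\<dots> \<le> (\<Sum>i<2 * m. T / real (2 * m) * - mbm_kernel H (real i * T / real (2 * m)) x)"
        proof (rule sum_mono2)
          show "0 \<le> T / real (2 * m) * - mbm_kernel H (real i * T / real (2 * m)) x" for i
            using mbm_kernel_nonpos[of H "real i * T / real (2 * m)" x, OF H'[OF t0] t0] True T
            by (intro mult_nonneg_nonneg) auto
        qed auto
        also have "\<dots> = - ?S x" by (simp add: sum_negf)
        finally have "c * T / 2 \<le> - ?S x" .
        moreover have "0 \<le> c * T / 2" using c T by simp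
        ultimately have "(c * T / 2)\<^sup>2 \<le> (- ?S x)\<^sup>2" by (rule power_mono)
        then show ?thesis using True by simp
      qed simp
    qed
    finally show ?thesis .
  qed
  moreover have "0 < c\<^sup>2 / 8" using c by simp
  ultimately show ?thesis by blast
qed

section \<open>Small ball estimate for the integral of the path\<close>

lemma outer_prob_nonneg: "0 \<le> outer_prob M S"
  unfolding outer_prob_def by (rule cInf_greatest) auto

lemma outer_prob_le:
  "A \<in> sets M \<Longrightarrow> S \<inter> space M \<subseteq> A \<Longrightarrow> outer_prob M S \<le> measure M A"
  unfolding outer_prob_def by (rule cInf_lower) (auto intro!: bdd_belowI[of _ 0])

text \<open>Fatou's lemma for events: the intersections increase with \<open>j\<close>, and each
  lies in \<open>U j\<close>.\<close>

lemma (in prob_space) measure_liminf_le: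
  fixes U :: "nat \<Rightarrow> 'a set"
  assumes U: "\<And>m. U m \<in> sets M" and le: "\<And>m. measure M (U m) \<le> b"
  shows "measure M (\<Union>j. \<Inter>m\<in>{j..}. U m) \<le> b"
proof -
  define A where "A j = (\<Inter>m\<in>{j..}. U m)" for j
  have A: "A j \<in> sets M" for j
    unfolding A_def using U by (intro sets.countable_INT') auto
  have "(\<lambda>j. measure M (A j)) \<longlonglongrightarrow> measure M (\<Union>j. A j)"
    using A by (intro finite_Lim_measure_incseq) (auto simp: incseq_def A_def)
  moreover have "measure M (A j) \<le> b" for j
  proof -
    have "measure M (A j) \<le> measure M (U j)"
      using U by (intro finite_measure_mono) (auto simp: A_def)
    then show ?thesis using le[of j] by linarith
  qed
  ultimately show ?thesis unfolding A_def by (intro LIMSEQ_le_const2) auto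
qed

lemma white_noise_single:
  assumes "prob_space M" "white_noise M W" "L2fun f"
  shows "W f \<in> borel_measurable M"
    and "distr M borel (W f) =
      distr std_normal_distribution borel (\<lambda>x. sqrt (LINT x|lborel. (f x)\<^sup>2) * x)"
  using white_noise_combination_distr[OF assms(1,2), of 1 "\<lambda>_. f" "\<lambda>_. 1"] assms
  by (auto simp: white_noise_def)

text \<open>A path whose integral is below the threshold has Riemann sums that are eventually below
  it, so it lies in the lower limit of the small ball events of these sums. Their standard deviation
  is at least \<open>sqrt (c * T ^ 3)\<close>, so the bound is free of \<open>T\<close>. A
  measurable cover \<open>A\<close> is produced to fit the outer probability.\<close>

lemma mbm_integral_small_ball:
  assumes "prob_space M" "white_noise M W"
    and h: "1/2 < h1" "h2 < 1" and H: "\<forall>t\<ge>0. h1 \<le> H t \<and> H t \<le> h2"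
    and Y: "\<And>t. 0 \<le> t \<Longrightarrow> AE \<omega> in M. Y \<omega> t = W (mbm_kernel H t) \<omega>"
    and X: "\<And>\<omega> t. \<omega> \<in> space M \<Longrightarrow> 0 \<le> t \<Longrightarrow> X \<omega> t = x0 + Y \<omega> t"
    and cont: "\<And>\<omega>. \<omega> \<in> space M \<Longrightarrow> continuous_on {0..T} (X \<omega>)"
    and c: "0 < c" "\<And>m. 0 < m \<Longrightarrow> c * T ^ 3 \<le>
      (LINT x|lborel. (\<Sum>i<2 * m. T / real (2 * m) * mbm_kernel H (real i * T / real (2 * m)) x)\<^sup>2)"
    and T: "0 < T" and e: "0 \<le> e"
  shows "\<exists>A\<in>sets M. measure M A \<le> 2 * e / sqrt c \<and>
    {\<omega>\<in>space M. \<bar>integral {0..T} (X \<omega>)\<bar> < e * sqrt (T ^ 3)} \<subseteq> A"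
proof -
  interpret prob_space M by fact
  \<comment> \<open>\<open>2 * Suc m\<close> cells: a positive even number, as the variance bound
    requires.\<close>
  define p where "p m i = real i * T / real (2 * Suc m)" for m i :: nat
  define S where "S m \<omega> = (\<Sum>i<2 * Suc m. T / real (2 * Suc m) * W (mbm_kernel H (p m i)) \<omega>)" for m \<omega>
  define a where "a = e * sqrt (T ^ 3)"
  define U where "U m = {\<omega>\<in>space M. \<bar>T * x0 + S m \<omega>\<bar> < a}" for m
  have p: "0 \<le> p m i" for m i using T by (simp add: p_def)
  have L2: "L2fun (mbm_kernel H (p m i))" for m i
    using H[rule_format, OF p] h p by (intro L2fun_mbm_kernel) (auto intro: less_le_trans le_less_trans)
  have [measurable]: "W (mbm_kernel H (p m i)) \<in> borel_measurable M" for m i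
    using L2 assms(2) by (auto simp: white_noise_def)
  have [measurable]: "S m \<in> borel_measurable M" for m
    unfolding S_def[abs_def] by measurable
  have U [measurable]: "U m \<in> sets M" for m
    unfolding U_def by measurable
  have U_le: "measure M (U m) \<le> 2 * e / sqrt c" for m
  proof -
    let ?v = "LINT x|lborel. (\<Sum>i<2 * Suc m. T / real (2 * Suc m) * mbm_kernel H (p m i) x)\<^sup>2"
    have v: "c * T ^ 3 \<le> ?v" using c(2)[of "Suc m"] unfolding p_def by simp
    have cT: "0 < c * T ^ 3" using c T by simp
    have "measure M (U m) \<le> 2 * a / sqrt ?v"
      unfolding U_def
    proof (rule normal_small_ball_le)
      show "distr M borel (S m) = distr std_normal_distribution borel (\<lambda>x. sqrt ?v * x)"
        unfolding S_def[abs_def] by (intro white_noise_combination_distr assms(1,2) L2)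
      show "0 < sqrt ?v" using v cT by simp
      show "0 \<le> a" using e T by (simp add: a_def)
    qed measurable
    also have "\<dots> \<le> 2 * a / sqrt (c * T ^ 3)"
      using v cT e T by (intro divide_left_mono mult_pos_pos) (auto simp: a_def)
    also have "\<dots> = 2 * e / sqrt c"
      using T by (simp add: a_def real_sqrt_mult)
    finally show ?thesis .
  qed
  \<comment> \<open>\<open>Y\<close> agrees with the white noise integral only almost surely at each
    fixed time; the partition points are countable, so one null set suffices for all of
    them.\<close>
  have "AE \<omega> in M. \<forall>m i. Y \<omega> (p m i) = W (mbm_kernel H (p m i)) \<omega>"
    using Y[OF p] by (simp add: AE_all_countable)
  then obtain N where N: "{\<omega>\<in>space M. \<not> (\<forall>m i. Y \<omega> (p m i) = W (mbm_kernel H (p m i)) \<omega>)} \<subseteq> N"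
      "emeasure M N = 0" "N \<in> sets M"
    by (rule AE_E)
  define V where "V = (\<Union>j. \<Inter>m\<in>{j..}. U m)"
  have V: "V \<in> sets M" unfolding V_def by (intro sets.countable_UN sets.countable_INT') auto
  have "measure M (N \<union> V) \<le> measure M N + measure M V"
    using N V by (intro measure_Un_le) auto
  also have "\<dots> \<le> 2 * e / sqrt c"
    using N measure_liminf_le[OF U U_le] by (simp add: measure_def V_def)
  finally have "measure M (N \<union> V) \<le> 2 * e / sqrt c" .
  moreover have "{\<omega>\<in>space M. \<bar>integral {0..T} (X \<omega>)\<bar> < a} \<subseteq> N \<union> V"
  proof
    fix \<omega> assume "\<omega> \<in> {\<omega>\<in>space M. \<bar>integral {0..T} (X \<omega>)\<bar> < a}"
    then have \<omega>: "\<omega> \<in> space M" and less: "\<bar>integral {0..T} (X \<omega>)\<bar> < a" by auto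
    show "\<omega> \<in> N \<union> V"
    proof (cases "\<omega> \<in> N")
      case False
      then have eq: "Y \<omega> (p m i) = W (mbm_kernel H (p m i)) \<omega>" for m i using N(1) \<omega> by auto
      have sm: "strict_mono (\<lambda>m. 2 * Suc m)" by (auto simp: strict_mono_def)
      have "((\<lambda>n. \<Sum>i<n. T / real n * X \<omega> (real i * T / real n)) \<circ> (\<lambda>m. 2 * Suc m))
          \<longlonglongrightarrow> integral {0..T} (X \<omega>)"
        by (rule LIMSEQ_subseq_LIMSEQ[OF Riemann_sum_tendsto[OF cont[OF \<omega>] T] sm])
      moreover have "((\<lambda>n. \<Sum>i<n. T / real n * X \<omega> (real i * T / real n)) \<circ> (\<lambda>m. 2 * Suc m)) m
          = T * x0 + S m \<omega>" for m
      proof -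
        have "(\<Sum>i<2 * Suc m. T / real (2 * Suc m) * X \<omega> (p m i))
            = (\<Sum>i<2 * Suc m. T / real (2 * Suc m) * x0 + T / real (2 * Suc m) * W (mbm_kernel H (p m i)) \<omega>)"
          using X[OF \<omega> p] eq by (simp only: distrib_left)
        also have "\<dots> = T * x0 + S m \<omega>"
          unfolding sum.distrib S_def sum_constant card_lessThan by (simp del: of_nat_Suc of_nat_mult)
        finally show ?thesis by (simp only: p_def o_def)
      qed
      ultimately have "(\<lambda>m. T * x0 + S m \<omega>) \<longlonglongrightarrow> integral {0..T} (X \<omega>)"
        by (simp only: o_def)
      then have "(\<lambda>m. \<bar>T * x0 + S m \<omega>\<bar>) \<longlonglongrightarrow> \<bar>integral {0..T} (X \<omega>)\<bar>"
        by (rule tendsto_rabs)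
      then have "eventually (\<lambda>m. \<bar>T * x0 + S m \<omega>\<bar> < a) sequentially"
        by (rule order_tendstoD(2)) (rule less)
      then show ?thesis using \<omega> by (auto simp: V_def U_def eventually_sequentially)
    qed simp
  qed
  ultimately show ?thesis using N(3) V unfolding a_def by (intro bexI[of _ "N \<union> V"]) auto
qed

section \<open>Convergence of the estimator\<close>

text \<open>Cauchy--Schwarz turns the lower bound on the integral of \<open>X\<close> into a
  denominator of at least \<open>e\<^sup>2 * T\<^sup>2\<close>, while the numerator is controlled by
  the endpoint values and the default value of \<open>THE\<close>.\<close>

lemma RS_ratio_le:
  fixes X :: "real \<Rightarrow> real"
  assumes cont: "continuous_on {0..T} X" and T: "0 < T" and e: "0 < e"
    and 0: "\<bar>X 0\<bar> \<le> b" "\<bar>X T\<bar> \<le> b" and I: "e * sqrt (T ^ 3) \<le> \<bar>integral {0..T} X\<bar>"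
  shows "\<bar>RS_integral X X T / integral {0..T} (\<lambda>s. (X s)\<^sup>2)\<bar> \<le> (\<bar>THE L. False\<bar> + b\<^sup>2) / (e\<^sup>2 * T\<^sup>2)"
proof -
  define Q where "Q = integral {0..T} (\<lambda>s. (X s)\<^sup>2)"
  have "(e * sqrt (T ^ 3))\<^sup>2 \<le> (integral {0..T} X)\<^sup>2"
    using I e T by (simp add: abs_le_square_iff[symmetric])
  also have "\<dots> \<le> T * Q"
    unfolding Q_def by (rule integral_square_ge[OF cont T])
  finally have "T * (e\<^sup>2 * T\<^sup>2) \<le> T * Q"
    using T by (simp add: power_mult_distrib power2_eq_square power3_eq_cube mult_ac)
  then have Q: "e\<^sup>2 * T\<^sup>2 \<le> Q" using T by simp
  have eT: "0 < e\<^sup>2 * T\<^sup>2" using e T by simp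
  have "(X T)\<^sup>2 \<le> b\<^sup>2" "(X 0)\<^sup>2 \<le> b\<^sup>2"
    using 0 by (auto simp: abs_le_square_iff[symmetric])
  then have "((X T)\<^sup>2 + (X 0)\<^sup>2) / 2 \<le> b\<^sup>2" by simp
  then have R: "\<bar>RS_integral X X T\<bar> \<le> \<bar>THE L. False\<bar> + b\<^sup>2"
    by (intro order_trans[OF abs_RS_integral_self_le[OF T]] add_left_mono)
  have "\<bar>RS_integral X X T / Q\<bar> = \<bar>RS_integral X X T\<bar> / Q"
    using Q eT by simp
  also have "\<dots> \<le> (\<bar>THE L. False\<bar> + b\<^sup>2) / (e\<^sup>2 * T\<^sup>2)"
    using R Q eT by (intro frac_le) auto
  finally show ?thesis by (simp add: Q_def)
qed

text \<open>The numerator grows at most like \<open>T powr (2 * h)\<close> up to constants, and h <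
  1. Moving \<open>1 / T\<close> inside the square makes every power of \<open>T\<close>
  negative.\<close>

lemma ratio_bound_tendsto_0:
  fixes k x0 s l h e :: real
  assumes "h < 1"
  shows "((\<lambda>T. (k + (\<bar>x0\<bar> + s * T powr h * l)\<^sup>2) / (e\<^sup>2 * T\<^sup>2)) \<longlongrightarrow> 0) at_top"
proof -
  have "((\<lambda>T. (k * T powr -2 + (\<bar>x0\<bar> * T powr -1 + s * T powr (h - 1) * l)\<^sup>2) / e\<^sup>2) \<longlongrightarrow>
      (k * 0 + (\<bar>x0\<bar> * 0 + s * 0 * l)\<^sup>2) / e\<^sup>2) at_top"
    unfolding divide_inverse using assms
    by (intro tendsto_add tendsto_mult tendsto_power tendsto_const tendsto_neg_powr filterlim_ident) auto
  then have "((\<lambda>T. (k * T powr -2 + (\<bar>x0\<bar> * T powr -1 + s * T powr (h - 1) * l)\<^sup>2) / e\<^sup>2)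
      \<longlongrightarrow> 0) at_top" by simp
  moreover have "eventually (\<lambda>T. (k * T powr -2 + (\<bar>x0\<bar> * T powr -1 + s * T powr (h - 1) * l)\<^sup>2) / e\<^sup>2
      = (k + (\<bar>x0\<bar> + s * T powr h * l)\<^sup>2) / (e\<^sup>2 * T\<^sup>2)) at_top"
    using eventually_gt_at_top[of 0]
  proof eventually_elim
    case (elim T)
    have "\<bar>x0\<bar> * T powr -1 + s * T powr (h - 1) * l = (\<bar>x0\<bar> + s * T powr h * l) / T"
      using elim by (simp add: powr_diff powr_minus divide_inverse algebra_simps)
    moreover have "k * T powr -2 = k / T\<^sup>2"
      using elim by (simp add: powr_minus divide_inverse)
    ultimately show ?case
      by (simp add: power_divide add_divide_distrib[symmetric] mult.commute)
  qed
  ultimately show ?thesis by (rule Lim_transform_eventually)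
qed

theorem theorem12:
  fixes M :: "'a measure" and W :: "(real \<Rightarrow> real) \<Rightarrow> 'a \<Rightarrow> real"
    and H :: "real \<Rightarrow> real" and Y X :: "'a \<Rightarrow> real \<Rightarrow> real"
    and h1 h2 D \<kappa> x0 \<theta> :: real
  assumes "prob_space M"
    and "white_noise M W"
    and "continuous_on {0..} H"
    and "\<forall>t\<ge>0. 0 < H t \<and> H t < 1"
    and "0 < h1" "h1 < h2" "h2 < 1" "\<forall>t\<ge>0. h1 \<le> H t \<and> H t \<le> h2"
    and "D > 0" "0 < \<kappa>" "\<kappa> \<le> 1"
    and "\<forall>s t. 0 < s \<and> s \<le> t \<longrightarrow> \<bar>H t - H s\<bar> \<le> D * (t - s) powr \<kappa>"
    and "min h1 \<kappa> > 1/2"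
    and "is_mbm M W H Y"
    and "\<theta> = 0"
    and "\<forall>\<omega>\<in>space M. \<forall>t\<ge>0. X \<omega> t = x0 + \<theta> * integral {0..t} (X \<omega>) + Y \<omega> t"
  shows "converges_in_prob M
           (\<lambda>T \<omega>. RS_integral (X \<omega>) (X \<omega>) T / integral {0..T} (\<lambda>s. (X \<omega> s)\<^sup>2)) \<theta>"
  unfolding converges_in_prob_def
proof (intro allI impI)
  interpret prob_space M by fact
  let ?Z = "\<lambda>T \<omega>. RS_integral (X \<omega>) (X \<omega>) T / integral {0..T} (\<lambda>s. (X \<omega> s)\<^sup>2)"
  let ?tail = "\<lambda>l. measure std_normal_distribution {x. l < \<bar>x\<bar>}"
  fix \<epsilon> :: real assume \<epsilon>: "0 < \<epsilon>"
  have h: "1/2 < h1" "h2 < 1" using assms(7,13) by auto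
  note H = assms(8)
  have Y: "AE \<omega> in M. Y \<omega> t = W (mbm_kernel H t) \<omega>" if "0 \<le> t" for t
    using assms(14) that by (simp add: is_mbm_def)
  have X: "X \<omega> t = x0 + Y \<omega> t" if "\<omega> \<in> space M" "0 \<le> t" for \<omega> t
    using assms(15,16) that by simp
  have cont: "continuous_on {0..T} (X \<omega>)" if "\<omega> \<in> space M" for \<omega> T
  proof -
    have "continuous_on {0..T} (\<lambda>t. x0 + Y \<omega> t)"
      using assms(14) that
      by (intro continuous_intros) (auto simp: is_mbm_def intro: continuous_on_subset)
    then show ?thesis
      by (rule continuous_on_cong[THEN iffD1, OF refl, rotated]) (use X[OF that] in auto)
  qed
  have L2: "L2fun (mbm_kernel H t)" if "0 \<le> t" for t
    using H[rule_format, OF that] h that by (intro L2fun_mbm_kernel) auto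
  obtain C where C: "0 \<le> C" "\<And>T. 1 \<le> T \<Longrightarrow>
      (LINT x|lborel. (mbm_kernel H T x)\<^sup>2) \<le> C * T powr (2 * h2)"
    using mbm_kernel_variance_le[OF h] H by (metis order_trans zero_le_one)
  obtain c where c: "0 < c" "\<And>T m. 2 \<le> T \<Longrightarrow> 0 < m \<Longrightarrow> c * T ^ 3 \<le>
      (LINT x|lborel. (\<Sum>i<2 * m. T / real (2 * m) * mbm_kernel H (real i * T / real (2 * m)) x)\<^sup>2)"
    using Riemann_sum_variance_ge[OF h] H by blast
  \<comment> \<open>\<open>Y\<close> need not be measurable, so the tail event is covered by that of
    the white noise integral together with a null set.\<close>
  have tail: "\<exists>A\<in>sets M. measure M A \<le> ?tail l \<and> {\<omega>\<in>space M. s * l < \<bar>Y \<omega> t\<bar>} \<subseteq> A"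
    if t: "0 \<le> t" and l: "0 \<le> l" and s: "sqrt (LINT x|lborel. (mbm_kernel H t x)\<^sup>2) \<le> s" for t l s
  proof -
    note W = white_noise_single[OF assms(1,2) L2[OF t]]
    obtain N where N: "{\<omega>\<in>space M. Y \<omega> t \<noteq> W (mbm_kernel H t) \<omega>} \<subseteq> N"
        "emeasure M N = 0" "N \<in> sets M"
      using Y[OF t] by (rule AE_E)
    define E where "E = {\<omega>\<in>space M. s * l < \<bar>W (mbm_kernel H t) \<omega>\<bar>}"
    have E: "E \<in> sets M" unfolding E_def using W(1) by measurable
    have "measure M E \<le> ?tail l"
      unfolding E_def by (rule normal_tail_le[OF W _ s l]) simp
    then have "measure M (N \<union> E) \<le> ?tail l"
      using N E measure_Un_le[of N M E] by (simp add: measure_def)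
    moreover have "{\<omega>\<in>space M. s * l < \<bar>Y \<omega> t\<bar>} \<subseteq> N \<union> E"
      using N(1) by (auto simp: E_def)
    ultimately show ?thesis using N(3) E by blast
  qed
  show "((\<lambda>T. outer_prob M {\<omega>\<in>space M. \<epsilon> < \<bar>?Z T \<omega> - \<theta>\<bar>}) \<longlongrightarrow> 0) at_top"
  proof (rule tendstoI)
    fix \<eta> :: real assume \<eta>: "0 < \<eta>"
    \<comment> \<open>Three exceptional sets will be discarded, each of probability at most
      \<open>\<eta> / 4\<close>: two Gaussian tails, fixed by \<open>l\<close>, and one small ball,
      fixed by \<open>e\<close>.\<close>
    obtain l :: nat where l: "?tail (real l) < \<eta> / 4"
      using order_tendstoD(2)[OF normal_tail_tendsto_0, of "\<eta> / 4"] \<eta>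
      by (auto simp: eventually_sequentially)
    define e where "e = \<eta> * sqrt c / 8"
    have e: "0 < e" "2 * e / sqrt c = \<eta> / 4" using \<eta> c by (auto simp: e_def)
    \<comment> \<open>The starting value plus \<open>l\<close> times the bound for the standard
      deviation: it dominates \<open>X\<close> at both endpoints off the tail events.\<close>
    define b where "b T = \<bar>x0\<bar> + sqrt C * T powr h2 * real l" for T
    have "((\<lambda>T. (\<bar>THE L. False\<bar> + (b T)\<^sup>2) / (e\<^sup>2 * T\<^sup>2)) \<longlongrightarrow> 0) at_top"
      unfolding b_def by (rule ratio_bound_tendsto_0[OF h(2)])
    then have "eventually (\<lambda>T. (\<bar>THE L. False\<bar> + (b T)\<^sup>2) / (e\<^sup>2 * T\<^sup>2) < \<epsilon>) at_top"
      by (rule order_tendstoD(2)) (rule \<epsilon>)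
    then show "eventually (\<lambda>T. dist (outer_prob M {\<omega>\<in>space M. \<epsilon> < \<bar>?Z T \<omega> - \<theta>\<bar>}) 0 < \<eta>) at_top"
      using eventually_ge_at_top[of 2]
    proof eventually_elim
      case (elim T)
      define s where "s = sqrt C * T powr h2"
      have s: "0 \<le> s" using C by (simp add: s_def)
      have "sqrt (LINT x|lborel. (mbm_kernel H T x)\<^sup>2) \<le> sqrt (C * T powr (2 * h2))"
        using C(2)[of T] elim by simp
      also have "\<dots> = s"
      proof -
        have "T powr (2 * h2) = (T powr h2)\<^sup>2"
          by (simp add: power2_eq_square powr_add[symmetric])
        then show ?thesis by (simp add: s_def real_sqrt_mult)
      qed
      finally have sT: "sqrt (LINT x|lborel. (mbm_kernel H T x)\<^sup>2) \<le> s" .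
      \<comment> \<open>At time 0 the variance vanishes, so the scale \<open>s\<close> chosen for
        time \<open>T\<close> is admissible there too.\<close>
      have "mbm_kernel H 0 x = 0" for x
        using mbm_kernel_eq[of H 0 x] H h by (simp add: mbm_kernel_def)
      then have s0: "sqrt (LINT x|lborel. (mbm_kernel H 0 x)\<^sup>2) \<le> s" using s by simp
      obtain A0 where A0: "A0 \<in> sets M" "measure M A0 \<le> ?tail (real l)"
          "{\<omega>\<in>space M. s * real l < \<bar>Y \<omega> 0\<bar>} \<subseteq> A0"
        using tail[OF order_refl _ s0, of "real l"] by auto
      obtain A1 where A1: "A1 \<in> sets M" "measure M A1 \<le> ?tail (real l)"
          "{\<omega>\<in>space M. s * real l < \<bar>Y \<omega> T\<bar>} \<subseteq> A1"
        using tail[OF _ _ sT, of "real l"] elim by auto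
      obtain A2 where A2: "A2 \<in> sets M" "measure M A2 \<le> 2 * e / sqrt c"
          "{\<omega>\<in>space M. \<bar>integral {0..T} (X \<omega>)\<bar> < e * sqrt (T ^ 3)} \<subseteq> A2"
        using mbm_integral_small_ball[OF assms(1,2) h H Y X cont c(1) c(2), of T e] elim e by auto
      have "{\<omega>\<in>space M. \<epsilon> < \<bar>?Z T \<omega> - \<theta>\<bar>} \<subseteq> A0 \<union> A1 \<union> A2"
      proof (rule subsetI, rule ccontr)
        fix \<omega> assume "\<omega> \<in> {\<omega>\<in>space M. \<epsilon> < \<bar>?Z T \<omega> - \<theta>\<bar>}" and not: "\<omega> \<notin> A0 \<union> A1 \<union> A2"
        then have \<omega>: "\<omega> \<in> space M" and Z: "\<epsilon> < \<bar>?Z T \<omega>\<bar>" using assms(15) by auto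
        have "\<bar>Y \<omega> 0\<bar> \<le> s * real l" "\<bar>Y \<omega> T\<bar> \<le> s * real l"
          using not A0(3) A1(3) \<omega> by (auto simp: not_less[symmetric])
        then have "\<bar>X \<omega> 0\<bar> \<le> b T" "\<bar>X \<omega> T\<bar> \<le> b T"
          using X[OF \<omega>, of 0] X[OF \<omega>, of T] elim by (auto simp: b_def s_def)
        moreover have "e * sqrt (T ^ 3) \<le> \<bar>integral {0..T} (X \<omega>)\<bar>"
          using not A2(3) \<omega> by (auto simp: not_less[symmetric])
        ultimately have "\<bar>?Z T \<omega>\<bar> \<le> (\<bar>THE L. False\<bar> + (b T)\<^sup>2) / (e\<^sup>2 * T\<^sup>2)"
          using elim e(1) by (intro RS_ratio_le[OF cont[OF \<omega>]]) auto
        then show False using Z elim by linarith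
      qed
      then have "outer_prob M {\<omega>\<in>space M. \<epsilon> < \<bar>?Z T \<omega> - \<theta>\<bar>} \<le> measure M (A0 \<union> A1 \<union> A2)"
        using A0 A1 A2 by (intro outer_prob_le) auto
      also have "\<dots> \<le> measure M A0 + measure M A1 + measure M A2"
        using A0 A1 A2 measure_Un_le[of "A0 \<union> A1" M A2] measure_Un_le[of A0 M A1]
        by auto
      also have "\<dots> < \<eta>" using A0 A1 A2 l e \<eta> by linarith
      finally show ?case using outer_prob_nonneg[of M] by (simp add: dist_real_def)
    qed
  qed
qed

end
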